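(* Let $(W,S)$ be a Coxeter system, $(X,\mathrm{ht})$ a quasiparabolic $W$-set, and $\tilde X$ its even double cover, a quasiparabolic $W\times A_1$-set with $A_1=\langle s_0\rangle$. Let $x,y\in X$. If $x\le y$ in the Bruhat order on $X$, then $\tilde x\le\tilde y$ and $s_0\tilde x\le s_0\tilde y$ in the Bruhat order on $\tilde X$. Conversely, if $(x,k)\le(y,l)$ in $\tilde X$ for some $k,l\in\mathbb F_2$, then $x\le y$ in $X$.
   Context: Coxeter systems $(W,S)$ have finite rank; $R(W)$ is the set of reflections, i.e. conjugates in $W$ of elements of $S$; $\ell$ is the length function. A product $W\times W'$ of Coxeter groups is a Coxeter group with simple reflections $S\sqcup S'$. A scaled $W$-set is a pair $(X,\mathrm{ht})$ with $X$ a (left) $W$-set and $\mathrm{ht}:X\to\mathbb Z$ a function with $|\mathrm{ht}(sx)-\mathrm{ht}(x)|\le 1$ for all $s\in S$, $x\in X$. A quasiparabolic $W$-set is a scaled $W$-set such that (QP1) for all $r\in R(W)$, $x\in X$, if $\mathrm{ht}(rx)=\mathrm{ht}(x)$ then $rx=x$; and (QP2) for all $r\in R(W)$, $x\in X$, $s\in S$, if $\mathrm{ht}(rx)>\mathrm{ht}(x)$ and $\mathrm{ht}(srx)<\mathrm{ht}(sx)$, then $rx=sx$. The Bruhat order on a quasiparabolic $W$-set is the weakest partial order such that for $x\in X$, $r\in R(W)$, $x\le rx$ iff $\mathrm{ht}(x)\le\mathrm{ht}(rx)$ (i.e. the reflexive-transitive closure of the relations $x<rx$ with $r \in R(W)$,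 $\mathrm{ht}(x)<\mathrm{ht}(rx)$). Even double cover: as a set $\tilde X=X\times\mathbb F_2$, with $W$-action $w(x,k)=(wx,k+\ell(w))$ and $A_1$-action $s_0(x,k)=(x,k+1)$; the height is $\widetilde{\mathrm{ht}}(x,k)=\mathrm{ht}(x)$ if $\mathrm{ht}(x)\equiv k\pmod 2$, and $\mathrm{ht}(x)+1$ otherwise. It is known that $\tilde X$ is quasiparabolic as a $W\times A_1$-set when $X$ is quasiparabolic. For $x\in X$, $\tilde x:=(x,\mathrm{ht}(x)\bmod 2)\in\tilde X$. *)

theory Defs
  imports "HOL-Algebra.Group_Action" "HOL-Library.Z2"
begin

section \<open>Coxeter systems\<close>

definition word_prod :: "('w, 'm) monoid_scheme \<Rightarrow> 'w list \<Rightarrow> 'w"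
  where "word_prod W ws = foldr (mult W) ws \<one>\<^bsub>W\<^esub>"

text \<open>
  In a Coxeter matrix the value \<^term>\<open>0::nat\<close> stands for infinity, that is, for the absence of a
  relation between \<open>s\<close> and \<open>t\<close> (the same convention as for the order of an element in HOL-Algebra).
\<close>

definition coxeter_matrix :: "'w set \<Rightarrow> ('w \<Rightarrow> 'w \<Rightarrow> nat) \<Rightarrow> bool"
  where "coxeter_matrix S m \<longleftrightarrow>
    (\<forall>s\<in>S. m s s = 1) \<and>
    (\<forall>s\<in>S. \<forall>t\<in>S. m s t = m t s) \<and>
    (\<forall>s\<in>S. \<forall>t\<in>S. s \<noteq> t \<longrightarrow> m s t \<noteq> 1)"

inductive insert_relator :: "'w set \<Rightarrow> ('w \<Rightarrow> 'w \<Rightarrow> nat) \<Rightarrow> 'w list \<Rightarrow> 'w list \<Rightarrow> bool"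
  for S m
  where "\<lbrakk>u \<in> lists S; v \<in> lists S; s \<in> S; t \<in> S\<rbrakk>
    \<Longrightarrow> insert_relator S m (u @ v) (u @ concat (replicate (m s t) [s, t]) @ v)"

text \<open>
  \<open>W\<close> has the presentation with generators \<open>S\<close> and relations \<open>(s t)\<^bsup>m s t\<^esup> = 1\<close>. Since these include
  \<open>s s = 1\<close>, the group so presented is the quotient of the free monoid on \<open>S\<close> by the congruence
  generated by the relations, so that words in formal inverses are not needed.
\<close>

definition coxeter_system :: "('w, 'm) monoid_scheme \<Rightarrow> 'w set \<Rightarrow> bool"
  where "coxeter_system W S \<longleftrightarrow>
    group W \<and> finite S \<and> S \<subseteq> carrier W \<and>
    word_prod W ` lists S = carrier W \<and>
    (\<exists>m. coxeter_matrix S m \<and>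
      (\<forall>u\<in>lists S. \<forall>v\<in>lists S.
        word_prod W u = word_prod W v \<longleftrightarrow> equivclp (insert_relator S m) u v))"

definition cox_length :: "('w, 'm) monoid_scheme \<Rightarrow> 'w set \<Rightarrow> 'w \<Rightarrow> nat"
  where "cox_length W S w = (LEAST n. \<exists>ws\<in>lists S. length ws = n \<and> word_prod W ws = w)"

definition reflections :: "('w, 'm) monoid_scheme \<Rightarrow> 'w set \<Rightarrow> 'w set"
  where "reflections W S = {w \<otimes>\<^bsub>W\<^esub> s \<otimes>\<^bsub>W\<^esub> inv\<^bsub>W\<^esub> w | w s. w \<in> carrier W \<and> s \<in> S}"

text \<open>The simple reflections of the direct product of two Coxeter groups.\<close>

definition prod_gens ::
  "('w, 'm) monoid_scheme \<Rightarrow> 'w set \<Rightarrow> ('v, 'n) monoid_scheme \<Rightarrow> 'v set \<Rightarrow> ('w \<times> 'v) set"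
  where "prod_gens W S V T = (\<lambda>s. (s, \<one>\<^bsub>V\<^esub>)) ` S \<union> (\<lambda>t. (\<one>\<^bsub>W\<^esub>, t)) ` T"


section \<open>Quasiparabolic sets\<close>

definition scaled_set ::
  "('w, 'm) monoid_scheme \<Rightarrow> 'w set \<Rightarrow> 'x set \<Rightarrow> ('w \<Rightarrow> 'x \<Rightarrow> 'x) \<Rightarrow> ('x \<Rightarrow> int) \<Rightarrow> bool"
  where "scaled_set W S X \<phi> ht \<longleftrightarrow>
    group_action W X \<phi> \<and> (\<forall>s\<in>S. \<forall>x\<in>X. \<bar>ht (\<phi> s x) - ht x\<bar> \<le> 1)"

definition quasiparabolic ::
  "('w, 'm) monoid_scheme \<Rightarrow> 'w set \<Rightarrow> 'x set \<Rightarrow> ('w \<Rightarrow> 'x \<Rightarrow> 'x) \<Rightarrow> ('x \<Rightarrow> int) \<Rightarrow> bool"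
  where "quasiparabolic W S X \<phi> ht \<longleftrightarrow>
    scaled_set W S X \<phi> ht \<and>
    (\<forall>r\<in>reflections W S. \<forall>x\<in>X. ht (\<phi> r x) = ht x \<longrightarrow> \<phi> r x = x) \<and>
    (\<forall>r\<in>reflections W S. \<forall>x\<in>X. \<forall>s\<in>S.
      ht (\<phi> r x) > ht x \<and> ht (\<phi> s (\<phi> r x)) < ht (\<phi> s x) \<longrightarrow> \<phi> r x = \<phi> s x)"

definition bruhat_step ::
  "('w, 'm) monoid_scheme \<Rightarrow> 'w set \<Rightarrow> 'x set \<Rightarrow> ('w \<Rightarrow> 'x \<Rightarrow> 'x) \<Rightarrow> ('x \<Rightarrow> int) \<Rightarrow> 'x \<Rightarrow> 'x \<Rightarrow> bool"
  where "bruhat_step W S X \<phi> ht x y \<longleftrightarrow>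
    x \<in> X \<and> (\<exists>r\<in>reflections W S. y = \<phi> r x \<and> ht x < ht y)"

definition bruhat_le ::
  "('w, 'm) monoid_scheme \<Rightarrow> 'w set \<Rightarrow> 'x set \<Rightarrow> ('w \<Rightarrow> 'x \<Rightarrow> 'x) \<Rightarrow> ('x \<Rightarrow> int) \<Rightarrow> 'x \<Rightarrow> 'x \<Rightarrow> bool"
  where "bruhat_le W S X \<phi> ht = (bruhat_step W S X \<phi> ht)\<^sup>*\<^sup>*"


section \<open>The even double cover\<close>

text \<open>
  \<open>A\<^sub>1\<close> is realised as the additive group of the two-element field \<^typ>\<open>bit\<close>. The coercions
  \<open>of_int\<close> and \<open>of_nat\<close> into \<^typ>\<open>bit\<close> are reduction modulo 2.
\<close>

definition A1 :: "bit monoid"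
  where "A1 = \<lparr>carrier = UNIV, mult = (+), one = 0\<rparr>"

definition s0 :: bit
  where "s0 = 1"

definition dc_set :: "'x set \<Rightarrow> ('x \<times> bit) set"
  where "dc_set X = X \<times> UNIV"

text \<open>
  The commuting actions of \<open>W\<close> and \<open>A\<^sub>1\<close> combined into one action of \<open>W \<times> A\<^sub>1\<close>. It is
  restricted to the double cover because actions in HOL-Algebra are by extensional functions.
\<close>

definition dc_act ::
  "('w, 'm) monoid_scheme \<Rightarrow> 'w set \<Rightarrow> 'x set \<Rightarrow> ('w \<Rightarrow> 'x \<Rightarrow> 'x)
    \<Rightarrow> 'w \<times> bit \<Rightarrow> 'x \<times> bit \<Rightarrow> 'x \<times> bit"
  where "dc_act W S X \<phi> = (\<lambda>(w, a). \<lambda>(x, k)\<in>dc_set X. (\<phi> w x, k + of_nat (cox_length W S w) + a))"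

definition dc_ht :: "('x \<Rightarrow> int) \<Rightarrow> 'x \<times> bit \<Rightarrow> int"
  where "dc_ht ht = (\<lambda>(x, k). if of_int (ht x) = k then ht x else ht x + 1)"

definition dc_lift :: "('x \<Rightarrow> int) \<Rightarrow> 'x \<Rightarrow> 'x \<times> bit"
  where "dc_lift ht x = (x, of_int (ht x))"

definition dc_bruhat_le ::
  "('w, 'm) monoid_scheme \<Rightarrow> 'w set \<Rightarrow> 'x set \<Rightarrow> ('w \<Rightarrow> 'x \<Rightarrow> 'x) \<Rightarrow> ('x \<Rightarrow> int)
    \<Rightarrow> 'x \<times> bit \<Rightarrow> 'x \<times> bit \<Rightarrow> bool"
  where "dc_bruhat_le W S X \<phi> ht =
    bruhat_le (W \<times>\<times> A1) (prod_gens W S A1 {s0}) (dc_set X) (dc_act W S X \<phi>) (dc_ht ht)"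

end

theory Submission
  imports Defs
begin

text \<open>
  A reflection \<open>r\<close> of \<open>W\<close> has odd length, so it sends \<open>(x, k)\<close> to \<open>(r x, k + 1)\<close>. Let \<open>x < r x = y\<close>.
  If \<open>ht y - ht x\<close> is odd, then \<open>r\<close> takes the lift of \<open>x\<close> to that of \<open>y\<close>, and likewise after applying
  \<open>s\<^sub>0\<close>. If it is even, it is at least 2, and the lifts form the chain
  \<open>x\<^sup>~ < s\<^sub>0 x\<^sup>~ < r s\<^sub>0 x\<^sup>~ = y\<^sup>~ < s\<^sub>0 y\<^sup>~\<close> with heights \<open>ht x\<close>, \<open>ht x + 1\<close>, \<open>ht y\<close>, \<open>ht y + 1\<close>.
  Conversely, the height of \<open>(x, k)\<close> is \<open>ht x\<close> or \<open>ht x + 1\<close>, so a step up along \<open>r\<close> in the double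
  cover cannot go down in \<open>X\<close>, and by (QP1) it is trivial there if it preserves the height.
\<close>

section \<open>Parity of the length\<close>

lemma word_prod_closed:
  assumes "group W" "S \<subseteq> carrier W" "u \<in> lists S"
  shows "word_prod W u \<in> carrier W"
proof -
  interpret group W by fact
  show ?thesis
    using assms(3) by (induction u) (use assms(2) in \<open>auto simp: word_prod_def\<close>)
qed

lemma word_prod_append:
  assumes "group W" "S \<subseteq> carrier W" "u \<in> lists S" "v \<in> lists S"
  shows "word_prod W (u @ v) = word_prod W u \<otimes>\<^bsub>W\<^esub> word_prod W v"
proof -
  interpret group W by fact
  have cl: "word_prod W w \<in> carrier W" if "w \<in> lists S" for w
    using word_prod_closed[OF assms(1,2) that] .
  show ?thesis
    using assms(3)
  proof (induction u)
    case Nil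
    then show ?case using cl[OF assms(4)] by (simp add: word_prod_def)
  next
    case (Cons a u)
    then have "a \<in> carrier W" "u \<in> lists S" using assms(2) by auto
    with Cons cl[OF assms(4)] cl[of u] show ?case
      by (simp add: word_prod_def m_assoc)
  qed
qed

text \<open>The inserted block has length \<open>2 * m s t\<close>, which is even; for
  \<open>m s t = 0\<close>, the code for infinity, it is empty.\<close>

lemma insert_relator_parity:
  assumes "insert_relator S m u v"
  shows "even (length u) \<longleftrightarrow> even (length v)"
  using assms by cases (auto simp: length_concat sum_list_replicate)

text \<open>This is the sign character of \<open>W\<close>: by the presentation, equal products are
  linked by inserting and deleting relators, and each such move keeps the parity.\<close>

lemma word_length_parity:
  assumes "coxeter_system W S" "u \<in> lists S" "v \<in> lists S" "word_prod W u = word_prod W v"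
  shows "even (length u) \<longleftrightarrow> even (length v)"
proof -
  obtain m where "equivclp (insert_relator S m) u v"
    using assms unfolding coxeter_system_def by blast
  then show ?thesis
    by (induction rule: equivclp_induct) (auto dest: insert_relator_parity)
qed

text \<open>The minimum is attained by some word for the same element, and all words for one element
  agree in parity.\<close>

lemma cox_length_parity:
  assumes "coxeter_system W S" "u \<in> lists S"
  shows "even (cox_length W S (word_prod W u)) \<longleftrightarrow> even (length u)"
proof -
  let ?P = "\<lambda>n. \<exists>ws\<in>lists S. length ws = n \<and> word_prod W ws = word_prod W u"
  have "?P (length u)" using assms(2) by blast
  then have "?P (cox_length W S (word_prod W u))"
    unfolding cox_length_def by (rule LeastI)
  then show ?thesis using word_length_parity[OF assms(1)] assms(2) by metis
qed

lemma even_cox_length_one: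
  assumes "coxeter_system W S"
  shows "even (cox_length W S \<one>\<^bsub>W\<^esub>)"
  using cox_length_parity[OF assms, of "[]"] by (simp add: word_prod_def)

lemma odd_cox_length_reflection:
  assumes "coxeter_system W S" "r \<in> reflections W S"
  shows "odd (cox_length W S r)"
proof -
  have grp: "group W" and S: "S \<subseteq> carrier W" and gen: "word_prod W ` lists S = carrier W"
    using assms(1) by (auto simp: coxeter_system_def)
  interpret group W by (rule grp)
  note app = word_prod_append[OF grp S]
  obtain w s where w: "w \<in> carrier W" and s: "s \<in> S" and r: "r = w \<otimes>\<^bsub>W\<^esub> s \<otimes>\<^bsub>W\<^esub> inv\<^bsub>W\<^esub> w"
    using assms(2) by (auto simp: reflections_def)
  \<comment> \<open>\<open>u\<close> and \<open>v\<close> are independent choices of words for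
    \<open>w\<close> and its inverse. As \<open>u @ v\<close> represents the identity, its length is
    even, and inserting the letter \<open>s\<close> makes it odd.\<close>
  obtain u where u: "u \<in> lists S" "word_prod W u = w" using gen w by (metis imageE)
  obtain v where v: "v \<in> lists S" "word_prod W v = inv\<^bsub>W\<^esub> w"
    using gen inv_closed[OF w] by (metis imageE)
  have uv: "u @ v \<in> lists S" and usv: "u @ [s] @ v \<in> lists S" using u v s by auto
  have sw: "word_prod W [s] = s" using s S by (auto simp: word_prod_def)
  have "word_prod W (u @ v) = word_prod W []"
    using app[OF u(1) v(1)] u v w by (simp add: word_prod_def)
  then have "even (length (u @ v))"
    using word_length_parity[OF assms(1) uv, of "[]"] by simp
  moreover have "word_prod W (u @ [s] @ v) = r"
    using app[OF u(1), of "[s] @ v"] app[of "[s]" v] u v s w S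
    by (auto simp: r sw m_assoc simp del: append_Cons append_Nil)
  ultimately show ?thesis using cox_length_parity[OF assms(1) usv] by simp
qed

lemma of_nat_bit_eq: "(of_nat n :: bit) = (if even n then 0 else 1)"
  by (induction n) auto

lemma of_int_bit_eq: "(of_int i :: bit) = (if even i then 0 else 1)"
  by (cases i rule: int_cases2) (auto simp: of_nat_bit_eq)


section \<open>Reflections and heights in the double cover\<close>

lemma group_A1: "group A1"
proof (rule groupI)
  fix a assume "a \<in> carrier A1"
  have "a + a = 0" by (cases a) auto
  then show "\<exists>b\<in>carrier A1. b \<otimes>\<^bsub>A1\<^esub> a = \<one>\<^bsub>A1\<^esub>" by (auto simp: A1_def)
qed (auto simp: A1_def add.assoc)

lemma inv_A1: "inv\<^bsub>A1\<^esub> a = a"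
  by (rule group.inv_equality[OF group_A1]) (cases a; simp add: A1_def)+

text \<open>Since \<open>A1\<close> is abelian, conjugation leaves the second component alone. Hence
  \<open>(s, 0)\<close> yields the reflections of \<open>W\<close>, while the central element
  \<open>(\<one>, s0)\<close> is its own only conjugate.\<close>

lemma reflections_dc:
  assumes "group W" "S \<subseteq> carrier W"
  shows "reflections (W \<times>\<times> A1) (prod_gens W S A1 {s0})
    = (\<lambda>r. (r, 0)) ` reflections W S \<union> {(\<one>\<^bsub>W\<^esub>, s0)}"
proof -
  interpret group W by fact
  have conj: "(w, a) \<otimes>\<^bsub>W \<times>\<times> A1\<^esub> (v, b) \<otimes>\<^bsub>W \<times>\<times> A1\<^esub> inv\<^bsub>W \<times>\<times> A1\<^esub> (w, a)
      = (w \<otimes>\<^bsub>W\<^esub> v \<otimes>\<^bsub>W\<^esub> inv\<^bsub>W\<^esub> w, b)" if "w \<in> carrier W" for w v and a b :: bit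
  proof -
    have "inv\<^bsub>W \<times>\<times> A1\<^esub> (w, a) = (inv\<^bsub>W\<^esub> w, a)"
      using inv_DirProd[OF assms(1) group_A1 that, of a]
      by (simp add: inv_A1) (simp add: A1_def)
    then show ?thesis by (cases a; cases b; simp add: A1_def)
  qed
  have one: "\<one>\<^bsub>A1\<^esub> = 0" and carrier: "carrier A1 = UNIV" by (simp_all add: A1_def)
  show ?thesis
  proof (intro equalityI subsetI)
    fix p assume "p \<in> reflections (W \<times>\<times> A1) (prod_gens W S A1 {s0})"
    then obtain w a t where w: "w \<in> carrier W" and t: "t \<in> prod_gens W S A1 {s0}"
      and p: "p = (w, a) \<otimes>\<^bsub>W \<times>\<times> A1\<^esub> t \<otimes>\<^bsub>W \<times>\<times> A1\<^esub> inv\<^bsub>W \<times>\<times> A1\<^esub> (w, a)"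
      by (auto simp: reflections_def)
    from t show "p \<in> (\<lambda>r. (r, 0)) ` reflections W S \<union> {(\<one>\<^bsub>W\<^esub>, s0)}"
      using w unfolding p by (auto simp: conj one prod_gens_def reflections_def image_iff simp del: mult_DirProd)
  next
    fix p assume "p \<in> (\<lambda>r. (r, 0)) ` reflections W S \<union> {(\<one>\<^bsub>W\<^esub>, s0)}"
    then obtain w t where "w \<in> carrier W" "t \<in> prod_gens W S A1 {s0}"
      and "p = (w, 0) \<otimes>\<^bsub>W \<times>\<times> A1\<^esub> t \<otimes>\<^bsub>W \<times>\<times> A1\<^esub> inv\<^bsub>W \<times>\<times> A1\<^esub> (w, 0)"
    proof (elim UnE)
      assume "p \<in> (\<lambda>r. (r, 0)) ` reflections W S"
      then obtain w s where "w \<in> carrier W" "s \<in> S" "p = (w \<otimes>\<^bsub>W\<^esub> s \<otimes>\<^bsub>W\<^esub> inv\<^bsub>W\<^esub> w, 0)"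
        by (auto simp: reflections_def)
      then show thesis
        by (intro that[of w "(s, 0)"]) (auto simp: conj one prod_gens_def simp del: mult_DirProd)
    next
      assume "p \<in> {(\<one>\<^bsub>W\<^esub>, s0)}"
      then show thesis
        by (intro that[of "\<one>\<^bsub>W\<^esub>" "(\<one>\<^bsub>W\<^esub>, s0)"]) (auto simp: conj prod_gens_def simp del: mult_DirProd)
    qed
    then show "p \<in> reflections (W \<times>\<times> A1) (prod_gens W S A1 {s0})"
      unfolding reflections_def carrier_DirProd carrier by blast
  qed
qed

lemma dc_act_reflection:
  assumes "coxeter_system W S" "r \<in> reflections W S" "x \<in> X"
  shows "dc_act W S X \<phi> (r, 0) (x, k) = (\<phi> r x, k + 1)"
  using odd_cox_length_reflection[OF assms(1,2)] assms(3)
  by (simp add: dc_act_def dc_set_def of_nat_bit_eq)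

lemma dc_act_s0:
  assumes "coxeter_system W S" "group_action W X \<phi>" "x \<in> X"
  shows "dc_act W S X \<phi> (\<one>\<^bsub>W\<^esub>, s0) (x, k) = (x, k + 1)"
  \<comment> \<open>\<open>id_eq_one\<close> identifies the action of the identity with the identity
    function restricted to \<open>X\<close>, so it has to be evaluated at
    \<open>x \<in> X\<close>.\<close>
  using even_cox_length_one[OF assms(1)] assms(3) group_action.id_eq_one[OF assms(2)]
  by (simp add: dc_act_def dc_set_def of_nat_bit_eq s0_def fun_eq_iff restrict_def split: if_splits)

text \<open>The fibre over \<open>x\<close> has a lower point, the lift of \<open>x\<close>, and an
  upper point, the lift moved by \<open>s0\<close>. Both are written out in coordinates from here
  on.\<close>

lemma dc_ht_lift:
  "dc_ht ht (x, of_int (ht x)) = ht x"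
  "dc_ht ht (x, of_int (ht x) + 1) = ht x + 1"
  by (simp_all add: dc_ht_def)

lemma dc_ht_bounds: "ht x \<le> dc_ht ht (x, k)" "dc_ht ht (x, k) \<le> ht x + 1"
  by (simp_all add: dc_ht_def)

lemma dc_bruhat_leI_reflection:
  assumes "coxeter_system W S" "r \<in> reflections W S" "x \<in> X"
    and "dc_ht ht (x, k) < dc_ht ht (\<phi> r x, k + 1)"
  shows "dc_bruhat_le W S X \<phi> ht (x, k) (\<phi> r x, k + 1)"
proof -
  have "group W" "S \<subseteq> carrier W" using assms(1) by (auto simp: coxeter_system_def)
  note reflections_dc[OF this]
  then show ?thesis
    unfolding dc_bruhat_le_def bruhat_le_def bruhat_step_def
    using assms dc_act_reflection[OF assms(1-3), of \<phi> k]
    by (intro r_into_rtranclp conjI bexI[of _ "(r, 0)"]) (simp_all add: dc_set_def)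
qed

lemma dc_bruhat_leI_s0:
  assumes "coxeter_system W S" "group_action W X \<phi>" "x \<in> X"
  shows "dc_bruhat_le W S X \<phi> ht (x, of_int (ht x)) (x, of_int (ht x) + 1)"
proof -
  have "group W" "S \<subseteq> carrier W" using assms(1) by (auto simp: coxeter_system_def)
  note reflections_dc[OF this]
  then show ?thesis
    unfolding dc_bruhat_le_def bruhat_le_def bruhat_step_def
    using assms dc_act_s0[OF assms, of "of_int (ht x)"] dc_ht_lift[of ht x]
    by (intro r_into_rtranclp conjI bexI[of _ "(\<one>\<^bsub>W\<^esub>, s0)"]) (simp_all add: dc_set_def)
qed

lemma dc_bruhat_le_trans:
  "dc_bruhat_le W S X \<phi> ht p q \<Longrightarrow> dc_bruhat_le W S X \<phi> ht q t \<Longrightarrow> dc_bruhat_le W S X \<phi> ht p t"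
  unfolding dc_bruhat_le_def bruhat_le_def by (rule rtranclp_trans)


section \<open>Comparison of the Bruhat orders\<close>

lemma bruhat_step_imp_dc_bruhat_le:
  assumes "coxeter_system W S" "group_action W X \<phi>" "bruhat_step W S X \<phi> ht x y" "y \<in> X"
  shows "dc_bruhat_le W S X \<phi> ht (x, of_int (ht x)) (y, of_int (ht y))"
    and "dc_bruhat_le W S X \<phi> ht (x, of_int (ht x) + 1) (y, of_int (ht y) + 1)"
proof -
  obtain r where x: "x \<in> X" and r: "r \<in> reflections W S" and y: "y = \<phi> r x" and lt: "ht x < ht y"
    using assms(3) by (auto simp: bruhat_step_def)
  let ?k = "of_int (ht x) :: bit" and ?l = "of_int (ht y) :: bit"
  note step = dc_bruhat_leI_reflection[OF assms(1) r x, of ht _ \<phi>, folded y]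
  have "dc_bruhat_le W S X \<phi> ht (x, ?k) (y, ?l) \<and>
    dc_bruhat_le W S X \<phi> ht (x, ?k + 1) (y, ?l + 1)"
  proof (cases "even (ht y - ht x)")
    case True
    then have l: "?k + 1 + 1 = ?l" by (auto simp: of_int_bit_eq)
    \<comment> \<open>A positive even difference is at least 2, so the upper point over
      \<open>x\<close> is still strictly below the lower point over \<open>y\<close>, and
      \<open>r\<close> joins the two.\<close>
    have "ht x + 1 < ht y" using True lt by presburger
    then have "dc_bruhat_le W S X \<phi> ht (x, ?k + 1) (y, ?l)"
      using step[of "?k + 1"] dc_ht_lift[of ht x] dc_ht_lift[of ht y] unfolding l by simp
    then show ?thesis
      \<comment> \<open>Prepending the \<open>s0\<close> step over \<open>x\<close> gives the first
        claim, appending the one over \<open>y\<close> gives the second.\<close>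
      using dc_bruhat_leI_s0[OF assms(1,2) x, of ht] dc_bruhat_leI_s0[OF assms(1,2,4), of ht]
      by (blast intro: dc_bruhat_le_trans)
  next
    case False
    then have l: "?k + 1 = ?l" by (auto simp: of_int_bit_eq)
    show ?thesis
      \<comment> \<open>The parity flip caused by \<open>r\<close> matches the odd difference, so
        lower goes to lower and upper to upper, both rising by \<open>ht y - ht x\<close>.\<close>
      using step[of ?k] step[of "?k + 1"] lt dc_ht_lift[of ht x] dc_ht_lift[of ht y]
      unfolding l by simp
  qed
  then show "dc_bruhat_le W S X \<phi> ht (x, ?k) (y, ?l)"
    and "dc_bruhat_le W S X \<phi> ht (x, ?k + 1) (y, ?l + 1)" by blast+
qed

lemma reflection_closed:
  assumes "coxeter_system W S" "r \<in> reflections W S"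
  shows "r \<in> carrier W"
proof -
  have "group W" "S \<subseteq> carrier W" using assms(1) by (auto simp: coxeter_system_def)
  then interpret group W by simp
  show ?thesis using assms(2) \<open>S \<subseteq> carrier W\<close> by (auto simp: reflections_def)
qed

lemma bruhat_step_closed:
  assumes "coxeter_system W S" "group_action W X \<phi>" "bruhat_step W S X \<phi> ht x y"
  shows "y \<in> X"
  using assms reflection_closed[OF assms(1)] group_action.element_image[OF assms(2)]
  by (auto simp: bruhat_step_def)

lemma bruhat_le_imp_dc_bruhat_le:
  assumes "coxeter_system W S" "group_action W X \<phi>" "bruhat_le W S X \<phi> ht x y"
  shows "dc_bruhat_le W S X \<phi> ht (x, of_int (ht x)) (y, of_int (ht y))"
    and "dc_bruhat_le W S X \<phi> ht (x, of_int (ht x) + 1) (y, of_int (ht y) + 1)"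
proof -
  have "dc_bruhat_le W S X \<phi> ht (x, of_int (ht x)) (y, of_int (ht y)) \<and>
    dc_bruhat_le W S X \<phi> ht (x, of_int (ht x) + 1) (y, of_int (ht y) + 1)"
    using assms(3) unfolding bruhat_le_def
  proof (induction rule: rtranclp_induct)
    case base
    then show ?case by (simp add: dc_bruhat_le_def bruhat_le_def)
  next
    case (step y z)
    note bruhat_step_imp_dc_bruhat_le[OF assms(1,2) step.hyps(2)
        bruhat_step_closed[OF assms(1,2) step.hyps(2)]]
    with step.IH show ?case by (blast intro: dc_bruhat_le_trans)
  qed
  then show "dc_bruhat_le W S X \<phi> ht (x, of_int (ht x)) (y, of_int (ht y))"
    and "dc_bruhat_le W S X \<phi> ht (x, of_int (ht x) + 1) (y, of_int (ht y) + 1)" by blast+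
qed

text \<open>The conclusion is \<open>bruhat_le\<close> and not a step, because a step along
  \<open>s0\<close>, or along a reflection fixing \<open>x\<close>, projects to an equality.\<close>

lemma dc_bruhat_step_imp_bruhat_le:
  assumes "coxeter_system W S" "quasiparabolic W S X \<phi> ht"
    and "bruhat_step (W \<times>\<times> A1) (prod_gens W S A1 {s0}) (dc_set X) (dc_act W S X \<phi>) (dc_ht ht) p q"
  shows "bruhat_le W S X \<phi> ht (fst p) (fst q)"
proof -
  have act: "group_action W X \<phi>" and
    qp1: "\<And>r x. r \<in> reflections W S \<Longrightarrow> x \<in> X \<Longrightarrow> ht (\<phi> r x) = ht x \<Longrightarrow> \<phi> r x = x"
    using assms(2) by (auto simp: quasiparabolic_def scaled_set_def)
  have "group W" "S \<subseteq> carrier W" using assms(1) by (auto simp: coxeter_system_def)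
  note refl = reflections_dc[OF this]
  obtain x k where p: "p = (x, k)" by (cases p)
  have x: "x \<in> X" using assms(3) by (auto simp: bruhat_step_def dc_set_def p)
  from assms(3) consider r where "r \<in> reflections W S" "q = dc_act W S X \<phi> (r, 0) (x, k)"
      "dc_ht ht (x, k) < dc_ht ht q"
    | "q = dc_act W S X \<phi> (\<one>\<^bsub>W\<^esub>, s0) (x, k)"
    by (auto simp: bruhat_step_def refl p)
  then show ?thesis
  proof cases
    case (1 r)
    then have q: "q = (\<phi> r x, k + 1)" by (simp add: dc_act_reflection[OF assms(1) _ x])
    \<comment> \<open>If the height dropped in \<open>X\<close>, the height of \<open>q\<close>
      would be at most \<open>ht (\<phi> r x) + 1 \<le> ht x\<close>, which is at most the height of
      \<open>(x, k)\<close>.\<close>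
    have "\<not> ht (\<phi> r x) < ht x"
      using 1(3) dc_ht_bounds[of ht x k] dc_ht_bounds[of ht "\<phi> r x" "k + 1"] by (simp add: q)
    then have "ht x < ht (\<phi> r x) \<or> \<phi> r x = x" using qp1[OF 1(1) x] by linarith
    then have "bruhat_step W S X \<phi> ht x (\<phi> r x) \<or> \<phi> r x = x"
      using 1(1) x by (auto simp: bruhat_step_def)
    then show ?thesis by (auto simp: p q bruhat_le_def)
  next
    case 2
    then show ?thesis
      using dc_act_s0[OF assms(1) act x] by (simp add: p bruhat_le_def)
  qed
qed

lemma dc_bruhat_le_imp_bruhat_le:
  assumes "coxeter_system W S" "quasiparabolic W S X \<phi> ht" "dc_bruhat_le W S X \<phi> ht p q"
  shows "bruhat_le W S X \<phi> ht (fst p) (fst q)"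
  \<comment> \<open>Only the order of the product group is unfolded, so that the induction runs on
    chains in the cover and the order on \<open>X\<close> stays folded in the goal.\<close>
  using assms(3) unfolding dc_bruhat_le_def bruhat_le_def[of "W \<times>\<times> A1"]
proof (induction rule: rtranclp_induct)
  case base
  then show ?case by (simp add: bruhat_le_def)
next
  case (step y z)
  then show ?case
    using dc_bruhat_step_imp_bruhat_le[OF assms(1,2) step.hyps(2)]
    unfolding bruhat_le_def by (blast intro: rtranclp_trans)
qed

theorem lemma5p6:
  fixes W :: "('w, 'm) monoid_scheme" and S :: "'w set"
    and X :: "'x set" and \<phi> :: "'w \<Rightarrow> 'x \<Rightarrow> 'x" and ht :: "'x \<Rightarrow> int"
    and x y :: 'x
  assumes "coxeter_system W S"
    and "quasiparabolic W S X \<phi> ht"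
    and "x \<in> X" and "y \<in> X"
  shows "(bruhat_le W S X \<phi> ht x y \<longrightarrow>
            dc_bruhat_le W S X \<phi> ht (dc_lift ht x) (dc_lift ht y) \<and>
            dc_bruhat_le W S X \<phi> ht
              (dc_act W S X \<phi> (\<one>\<^bsub>W\<^esub>, s0) (dc_lift ht x))
              (dc_act W S X \<phi> (\<one>\<^bsub>W\<^esub>, s0) (dc_lift ht y)))
       \<and> ((\<exists>k l :: bit. dc_bruhat_le W S X \<phi> ht (x, k) (y, l)) \<longrightarrow> bruhat_le W S X \<phi> ht x y)"
proof -
  have act: "group_action W X \<phi>"
    using assms(2) by (simp add: quasiparabolic_def scaled_set_def)
  show ?thesis
    using bruhat_le_imp_dc_bruhat_le[OF assms(1) act]
      dc_bruhat_le_imp_bruhat_le[OF assms(1,2), of "(x, _)" "(y, _)"]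
    by (auto simp: dc_lift_def dc_act_s0[OF assms(1) act assms(3)] dc_act_s0[OF assms(1) act assms(4)])
qed

end
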